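(* Let $\epsilon>0$ and $P_0>0$ be fixed, let $a=\{a_k\}_{k=1}^\infty$ be a decreasing sequence with $a_k>0$, and let $\sigma_j>0$, $1\le j<\infty$, be known constants. Suppose one observes $y=\{y_j\}_{j=1}^\infty$ with $y_j=x_j+\epsilon\sigma_j\xi_j$, where $\xi_j$ are independent standard Gaussian random variables and $x=\{x_j\}_{j=1}^\infty$ is an unknown element of $$B(a,P_0)=\Big\{x=\{x_i\}_{i=1}^\infty:\ \sup_k a_k^{-1}\sum_{j=k}^\infty x_j^2\le P_0\Big\}.$$ Assume that (i) there is $c>0$ such that $c<\sigma_j^2<\infty$ for all $j$; (ii) for all $j>1$, $$\frac{\sigma_j^2(a_{j-1}-a_j)}{\sigma_{j-1}^2(a_j-a_{j+1})}>1 .$$ Then the linear estimator $\hat x_\lambda=\{\lambda_j y_j\}_{j=1}^\infty$ with $$\lambda_j=\frac{P_0(a_j-a_{j+1})}{P_0(a_j-a_{j+1})+\epsilon^2\sigma_j^2}$$ is minimax on $B(a,P_0)$ in the class of all linear estimators, and the minimax risk equals $$R_{l\epsilon}=\epsilon^2\sum_{j=1}^\infty\frac{P_0\sigma_j^2(a_j-a_{j+1})}{P_0(a_j-a_{j+1})+\epsilon^2\sigma_j^2}.$$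
   Context: For $x=\{x_j\}_{j=1}^\infty$, $\|x\|^2=\sum_{j=1}^\infty x_j^2$; $E_x$ denotes expectation when the true parameter is $x$. The class of linear estimators consists of all estimators $\hat x_{\epsilon\lambda}=\{\lambda_j y_j\}_{j=1}^\infty$ with $\lambda=\{\lambda_j\}_{j=1}^\infty$, $\lambda_j\in\mathbb{R}$. A linear estimator $\hat x_\epsilon$ is called minimax in the class of linear estimators (on $B=B(a,P_0)$) if $$R_{l\epsilon}:=\sup_{x\in B}E_x\|\hat x_\epsilon-x\|^2=\inf_\lambda\sup_{x\in B}E_x\|\hat x_{\epsilon\lambda}-x\|^2,$$ and $R_{l\epsilon}$ is the corresponding minimax risk.
   Formalization: The formal statement additionally assumes that a_k tends to 0; without this the stated risk formula is false (e.g. a_k = 1 + 2^{-k}, sigma_j = epsilon = P_0 = 1), since the minimax risk then gains the extra term P_0 lim a_k. *)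

theory Defs
  imports "HOL-Probability.Probability"
begin

text \<open>
  Sequences are indexed from 0: \<open>x j\<close> stands for $x_{j+1}$, uniformly for all sequences.
  Squared norms and risks may be infinite, so they are valued in \<^typ>\<open>ennreal\<close>.
\<close>

definition sq_norm :: "(nat \<Rightarrow> real) \<Rightarrow> ennreal" where
  "sq_norm x = (\<Sum>j. ennreal ((x j)\<^sup>2))"

text \<open>The parameter set $B(a,P_0)$; the inner sum is the tail $\sum_{j \ge k} x_j^2$.\<close>

definition ball_B :: "(nat \<Rightarrow> real) \<Rightarrow> real \<Rightarrow> (nat \<Rightarrow> real) set" where
  "ball_B a P0 =
     {x. (SUP k. ennreal (inverse (a k)) * (\<Sum>j. ennreal ((x (k + j))\<^sup>2))) \<le> ennreal P0}"

definition observation ::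
    "real \<Rightarrow> (nat \<Rightarrow> real) \<Rightarrow> (nat \<Rightarrow> 'w \<Rightarrow> real) \<Rightarrow> (nat \<Rightarrow> real) \<Rightarrow> 'w \<Rightarrow> nat \<Rightarrow> real" where
  "observation \<epsilon> \<sigma> \<xi> x \<omega> j = x j + \<epsilon> * \<sigma> j * \<xi> j \<omega>"

definition standard_gaussian_noise :: "'w measure \<Rightarrow> (nat \<Rightarrow> 'w \<Rightarrow> real) \<Rightarrow> bool" where
  "standard_gaussian_noise M \<xi> \<longleftrightarrow>
     prob_space M \<and>
     prob_space.indep_vars M (\<lambda>_. borel) \<xi> UNIV \<and>
     (\<forall>j. distributed M lborel (\<xi> j) std_normal_density)"

text \<open>An estimator maps an observed sequence to an estimated one.\<close>

type_synonym estimator = "(nat \<Rightarrow> real) \<Rightarrow> nat \<Rightarrow> real"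

definition linear_estimator :: "(nat \<Rightarrow> real) \<Rightarrow> estimator" where
  "linear_estimator l y j = l j * y j"

text \<open>The risk $E_x \|\hat x - x\|^2$ under the true parameter \<open>x\<close>.\<close>

definition risk ::
    "'w measure \<Rightarrow> (nat \<Rightarrow> 'w \<Rightarrow> real) \<Rightarrow> real \<Rightarrow> (nat \<Rightarrow> real) \<Rightarrow> estimator \<Rightarrow> (nat \<Rightarrow> real) \<Rightarrow> ennreal"
  where
  "risk M \<xi> \<epsilon> \<sigma> est x =
     (\<integral>\<^sup>+\<omega>. sq_norm (\<lambda>j. est (observation \<epsilon> \<sigma> \<xi> x \<omega>) j - x j) \<partial>M)"

definition max_risk ::
    "'w measure \<Rightarrow> (nat \<Rightarrow> 'w \<Rightarrow> real) \<Rightarrow> real \<Rightarrow> (nat \<Rightarrow> real) \<Rightarrow> (nat \<Rightarrow> real) set \<Rightarrow> estimator \<Rightarrow> ennreal"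
  where
  "max_risk M \<xi> \<epsilon> \<sigma> B est = (SUP x\<in>B. risk M \<xi> \<epsilon> \<sigma> est x)"

definition linear_minimax_risk ::
    "'w measure \<Rightarrow> (nat \<Rightarrow> 'w \<Rightarrow> real) \<Rightarrow> real \<Rightarrow> (nat \<Rightarrow> real) \<Rightarrow> (nat \<Rightarrow> real) set \<Rightarrow> ennreal"
  where
  "linear_minimax_risk M \<xi> \<epsilon> \<sigma> B = (INF l. max_risk M \<xi> \<epsilon> \<sigma> B (linear_estimator l))"

definition linear_minimax ::
    "'w measure \<Rightarrow> (nat \<Rightarrow> 'w \<Rightarrow> real) \<Rightarrow> real \<Rightarrow> (nat \<Rightarrow> real) \<Rightarrow> (nat \<Rightarrow> real) set \<Rightarrow> estimator \<Rightarrow> bool"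
  where
  "linear_minimax M \<xi> \<epsilon> \<sigma> B est \<longleftrightarrow>
     est \<in> range linear_estimator \<and>
     max_risk M \<xi> \<epsilon> \<sigma> B est = linear_minimax_risk M \<xi> \<epsilon> \<sigma> B"

end

theory Submission
  imports Defs
begin

text \<open>
  The noise coordinates are centred with unit variance, so the risk of a linear estimator splits
  into squared bias plus variance, coordinate by coordinate (\<open>risk_linear_estimator\<close>):
  \<open>\<Sum>j. (1 - l j)\<^sup>2 * (x j)\<^sup>2 + \<epsilon>\<^sup>2 * (\<sigma> j)\<^sup>2 * (l j)\<^sup>2\<close>.

  Write \<open>d j = P0 * (a j - a (j + 1))\<close> and let \<open>x\<^sup>*\<close> be the parameter with \<open>(x\<^sup>* j)\<^sup>2 = d j\<close>.
  Since \<open>a\<close> decreases to zero, the tails of \<open>d\<close> telescope to \<open>P0 * a k\<close>; so \<open>x\<^sup>*\<close> meets every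
  constraint of the ball with equality.  It is a least favourable parameter, and the pair formed by
  \<open>x\<^sup>*\<close> and the stated coefficients \<open>l\<^sup>*\<close> is a saddle point of the risk.

  In one direction, \<open>l\<^sup>*\<close> minimises the risk at \<open>x\<^sup>*\<close>: each coordinate contributes a quadratic in
  \<open>l j\<close>, which is minimised separately (\<open>bias_variance_ge_min\<close>).  In the other direction, \<open>x\<^sup>*\<close>
  maximises the risk of \<open>l\<^sup>*\<close> over the ball.  The ratio condition says that the noise-to-signal
  ratios \<open>\<epsilon>\<^sup>2 * (\<sigma> j)\<^sup>2 / d j\<close> increase, hence so do the bias weights \<open>(1 - l\<^sup>* j)\<^sup>2\<close>.  A sum with
  increasing weights is, by summation by parts, a nonnegative combination of the tails of the
  summands (\<open>suminf_incseq_weights_mono\<close>), and no element of the ball has a tail larger than the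
  corresponding tail of \<open>x\<^sup>*\<close>.  The saddle value is the claimed minimax risk; it is finite because
  each of its terms is at most \<open>d j\<close> and \<open>d\<close> is summable.
\<close>

section \<open>Sums with increasing weights\<close>

lemma suminf_ennreal_swap:
  fixes f :: "nat \<Rightarrow> nat \<Rightarrow> ennreal"
  shows "(\<Sum>i. \<Sum>j. f i j) = (\<Sum>j. \<Sum>i. f i j)"
proof -
  have "(\<Sum>j. \<Sum>i. f i j) = (\<integral>\<^sup>+j. (\<Sum>i. f i j) \<partial>count_space UNIV)"
    by (simp add: nn_integral_count_space_nat)
  also have "\<dots> = (\<Sum>i. \<integral>\<^sup>+j. f i j \<partial>count_space UNIV)"
    by (intro nn_integral_suminf) auto
  finally show ?thesis
    by (simp add: nn_integral_count_space_nat)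
qed

text \<open>
  Summation by parts.  In \<^typ>\<open>ennreal\<close> it is an exchange of two nonnegative sums: the weight
  \<open>w j\<close> is the sum of the increments \<open>\<delta> k\<close> with \<open>k \<le> j\<close>, so \<open>\<delta> k\<close> multiplies the tail from \<open>k\<close>.
\<close>

lemma suminf_weights_by_tails:
  fixes \<delta> u :: "nat \<Rightarrow> ennreal"
  shows "(\<Sum>j. (\<Sum>k\<le>j. \<delta> k) * u j) = (\<Sum>k. \<delta> k * (\<Sum>j. u (k + j)))"
proof -
  have "(\<Sum>k. if k \<le> j then \<delta> k * u j else 0) = (\<Sum>k\<le>j. \<delta> k) * u j" for j
    by (subst suminf_finite[of "{..j}"]) (auto simp: sum_distrib_right)
  moreover have "(\<Sum>j. if k \<le> j then \<delta> k * u j else 0) = \<delta> k * (\<Sum>j. u (k + j))" for k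
    by (subst suminf_offset[where i = k]) (auto simp: add.commute)
  ultimately show ?thesis
    using suminf_ennreal_swap[of "\<lambda>j k. if k \<le> j then \<delta> k * u j else 0"] by simp
qed

lemma suminf_incseq_weights_mono:
  fixes w :: "nat \<Rightarrow> real" and u v :: "nat \<Rightarrow> ennreal"
  assumes "incseq w" and "0 \<le> w 0"
    and tails: "\<And>k. (\<Sum>j. u (k + j)) \<le> (\<Sum>j. v (k + j))"
  shows "(\<Sum>j. ennreal (w j) * u j) \<le> (\<Sum>j. ennreal (w j) * v j)"
proof -
  define \<delta> where "\<delta> k = (case k of 0 \<Rightarrow> w 0 | Suc i \<Rightarrow> w (Suc i) - w i)" for k
  have "0 \<le> \<delta> k" for k
    using assms(2) incseq_SucD[OF assms(1)] by (cases k) (simp_all add: \<delta>_def)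
  moreover have "(\<Sum>k\<le>j. \<delta> k) = w j" for j
    by (induction j) (simp_all add: \<delta>_def)
  ultimately have w_eq: "ennreal (w j) = (\<Sum>k\<le>j. ennreal (\<delta> k))" for j
    by simp
  have "(\<Sum>k. ennreal (\<delta> k) * (\<Sum>j. u (k + j))) \<le> (\<Sum>k. ennreal (\<delta> k) * (\<Sum>j. v (k + j)))"
    by (rule suminf_le) (rule mult_left_mono[OF tails], simp_all)
  then show ?thesis
    by (simp only: w_eq suminf_weights_by_tails)
qed

section \<open>The risk of a linear estimator\<close>

lemma nn_integral_affine_std_normal_square:
  assumes "distributed M lborel X std_normal_density"
  shows "(\<integral>\<^sup>+\<omega>. ennreal ((b + c * X \<omega>)\<^sup>2) \<partial>M) = ennreal (b\<^sup>2 + c\<^sup>2)"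
proof -
  let ?p = std_normal_density
  have "has_bochner_integral lborel (\<lambda>x. b\<^sup>2 * ?p x + 2 * b * c * (?p x * x) + c\<^sup>2 * (?p x * x\<^sup>2))
          (b\<^sup>2 * 1 + 2 * b * c * 0 + c\<^sup>2 * 1)"
    using std_normal_moment_even[of 0] std_normal_moment_odd[of 0] std_normal_moment_even[of 1]
    by (intro has_bochner_integral_add has_bochner_integral_mult_right) simp_all
  then have "has_bochner_integral lborel (\<lambda>x. ?p x * (b + c * x)\<^sup>2) (b\<^sup>2 + c\<^sup>2)"
    by (simp add: power2_eq_square algebra_simps)
  then have "(\<integral>\<^sup>+x. ennreal (?p x * (b + c * x)\<^sup>2) \<partial>lborel) = ennreal (b\<^sup>2 + c\<^sup>2)"
    by (subst nn_integral_eq_integral) (auto simp: has_bochner_integral_iff)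
  moreover have "(\<integral>\<^sup>+x. ennreal (?p x) * ennreal ((b + c * x)\<^sup>2) \<partial>lborel)
      = (\<integral>\<^sup>+\<omega>. ennreal ((b + c * X \<omega>)\<^sup>2) \<partial>M)"
    by (rule distributed_nn_integral[OF assms]) simp
  ultimately show ?thesis
    by (simp add: ennreal_mult)
qed

lemma risk_linear_estimator:
  assumes "standard_gaussian_noise M \<xi>"
  shows "risk M \<xi> \<epsilon> \<sigma> (linear_estimator l) x
    = (\<Sum>j. ennreal ((1 - l j)\<^sup>2 * (x j)\<^sup>2 + \<epsilon>\<^sup>2 * (\<sigma> j)\<^sup>2 * (l j)\<^sup>2))"
proof -
  have distr: "distributed M lborel (\<xi> j) std_normal_density" for j
    using assms by (auto simp: standard_gaussian_noise_def)
  have [measurable]: "\<xi> j \<in> borel_measurable M" for j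
    using distributed_measurable[OF distr] by simp
  have "risk M \<xi> \<epsilon> \<sigma> (linear_estimator l) x
      = (\<integral>\<^sup>+\<omega>. (\<Sum>j. ennreal (((l j - 1) * x j + (l j * \<epsilon> * \<sigma> j) * \<xi> j \<omega>)\<^sup>2)) \<partial>M)"
    by (simp add: risk_def sq_norm_def linear_estimator_def observation_def algebra_simps)
  also have "\<dots> = (\<Sum>j. \<integral>\<^sup>+\<omega>. ennreal (((l j - 1) * x j + (l j * \<epsilon> * \<sigma> j) * \<xi> j \<omega>)\<^sup>2) \<partial>M)"
    by (intro nn_integral_suminf) measurable
  also have "\<dots> = (\<Sum>j. ennreal (((l j - 1) * x j)\<^sup>2 + (l j * \<epsilon> * \<sigma> j)\<^sup>2))"
    by (simp add: nn_integral_affine_std_normal_square[OF distr])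
  finally show ?thesis
    by (simp add: power_mult_distrib power2_commute[of 1] mult_ac)
qed

section \<open>The scalar bias-variance trade-off\<close>

text \<open>
  Here \<open>p\<close> is the squared signal and \<open>q\<close> the noise variance in one coordinate.  The completed square
  gives both halves of the saddle point: the bound for every \<open>l\<close> and the value at the optimal one.
\<close>

lemma bias_variance_complete_square:
  fixes p q l :: real
  assumes "p + q > 0"
  shows "(1 - l)\<^sup>2 * p + q * l\<^sup>2 = p * q / (p + q) + (p + q) * (l - p / (p + q))\<^sup>2"
proof -
  have "(p + q) * ((1 - l)\<^sup>2 * p + q * l\<^sup>2) = p * q + ((p + q) * l - p)\<^sup>2"
    by (simp add: power2_eq_square algebra_simps)
  moreover have "(p + q) * l - p = (p + q) * (l - p / (p + q))"
    using assms by (simp add: right_diff_distrib)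
  ultimately have "(p + q) * ((1 - l)\<^sup>2 * p + q * l\<^sup>2)
      = (p + q) * (p * q / (p + q) + (p + q) * (l - p / (p + q))\<^sup>2)"
    using assms by (simp add: distrib_left power2_eq_square)
  then show ?thesis
    using assms by (subst (asm) mult_cancel_left) auto
qed

lemma bias_variance_min:
  fixes p q :: real
  assumes "p + q > 0"
  shows "(1 - p / (p + q))\<^sup>2 * p + q * (p / (p + q))\<^sup>2 = p * q / (p + q)"
  using bias_variance_complete_square[OF assms, of "p / (p + q)"] by simp

lemma bias_variance_ge_min:
  fixes p q l :: real
  assumes "p + q > 0"
  shows "p * q / (p + q) \<le> (1 - l)\<^sup>2 * p + q * l\<^sup>2"
  using assms by (simp add: bias_variance_complete_square)

section \<open>The ball and its least favourable element\<close>

lemma ball_B_iff_tails: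
  assumes "\<And>k. a k > 0" and "P0 \<ge> 0"
  shows "x \<in> ball_B a P0 \<longleftrightarrow> (\<forall>k. (\<Sum>j. ennreal ((x (k + j))\<^sup>2)) \<le> ennreal (P0 * a k))"
proof -
  have "ennreal (inverse (a k)) * t \<le> ennreal P0 \<longleftrightarrow> t \<le> ennreal (P0 * a k)" for k t
  proof (cases t)
    case (real r)
    have "inverse (a k) * r \<le> P0 \<longleftrightarrow> r \<le> P0 * a k"
      using assms(1)[of k] by (simp add: field_simps)
    then show ?thesis
      using real assms(2) assms(1)[of k]
      by (simp add: ennreal_mult[symmetric] ennreal_le_iff)
  next
    case top
    then show ?thesis
      using assms(1)[of k] by (simp add: ennreal_mult_top top_unique)
  qed
  then show ?thesis
    by (simp only: ball_B_def SUP_le_iff mem_Collect_eq ball_UNIV)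
qed

lemma decrements_tail_sums:
  fixes a :: "nat \<Rightarrow> real"
  assumes "a \<longlonglongrightarrow> 0"
  shows "(\<lambda>j. P0 * (a (k + j) - a (k + j + 1))) sums (P0 * a k)"
proof -
  have "(\<lambda>j. a (k + j)) \<longlonglongrightarrow> 0"
    using LIMSEQ_ignore_initial_segment[OF assms, of k] by (simp add: add.commute)
  from sums_mult[OF telescope_sums'[OF this], of P0] show ?thesis
    by simp
qed

section \<open>The minimax linear estimator\<close>

theorem theorem2p1:
  fixes M :: "'w measure" and \<xi> :: "nat \<Rightarrow> 'w \<Rightarrow> real"
    and \<epsilon> P0 :: real and a \<sigma> :: "nat \<Rightarrow> real"
  assumes "\<epsilon> > 0" and "P0 > 0"
    and "decseq a" and "\<And>k. a k > 0" and "a \<longlonglongrightarrow> 0"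
    and "\<And>j. \<sigma> j > 0"
    and "standard_gaussian_noise M \<xi>"
    and "\<exists>c>0. \<forall>j. c < (\<sigma> j)\<^sup>2"
    and "\<And>j. (\<sigma> (j + 1))\<^sup>2 * (a j - a (j + 1)) / ((\<sigma> j)\<^sup>2 * (a (j + 1) - a (j + 2))) > 1"
  shows "linear_minimax M \<xi> \<epsilon> \<sigma> (ball_B a P0)
           (linear_estimator (\<lambda>j. P0 * (a j - a (j + 1)) / (P0 * (a j - a (j + 1)) + \<epsilon>\<^sup>2 * (\<sigma> j)\<^sup>2)))
       \<and> summable (\<lambda>j. P0 * (\<sigma> j)\<^sup>2 * (a j - a (j + 1)) / (P0 * (a j - a (j + 1)) + \<epsilon>\<^sup>2 * (\<sigma> j)\<^sup>2))
       \<and> linear_minimax_risk M \<xi> \<epsilon> \<sigma> (ball_B a P0) =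
           ennreal (\<epsilon>\<^sup>2 * (\<Sum>j. P0 * (\<sigma> j)\<^sup>2 * (a j - a (j + 1))
                                  / (P0 * (a j - a (j + 1)) + \<epsilon>\<^sup>2 * (\<sigma> j)\<^sup>2)))"
proof -
  define d where "d j = P0 * (a j - a (j + 1))" for j
  define q where "q j = \<epsilon>\<^sup>2 * (\<sigma> j)\<^sup>2" for j
  define r where "r j = P0 * (\<sigma> j)\<^sup>2 * (a j - a (j + 1)) / (d j + q j)" for j
  define l where "l j = d j / (d j + q j)" for j
  define x where "x j = sqrt (d j)" for j
  define R where "R = (\<Sum>j. ennreal (d j * q j / (d j + q j)))"
  let ?B = "ball_B a P0"

  (* Division by zero yields 0, so the ratio condition excludes vanishing decrements. *)
  have "a j - a (j + 1) \<noteq> 0" for j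
    using assms(9)[of j] by auto
  moreover have "a (j + 1) \<le> a j" for j
    using assms(3) by (simp add: decseq_SucD)
  ultimately have decr_pos: "a j - a (j + 1) > 0" for j
    by (metis diff_ge_0_iff_ge order_le_less)
  then have d_pos: "d j > 0" and q_pos: "q j > 0" for j
    using assms(1,2) assms(6)[of j] by (auto simp: d_def q_def)
  have dq_pos: "d j + q j > 0" for j
    using d_pos[of j] q_pos[of j] by simp

  have tail: "(\<Sum>j. ennreal (d (k + j))) = ennreal (P0 * a k)" for k
    unfolding d_def using decr_pos assms(2)
    by (intro suminf_ennreal_eq decrements_tail_sums[OF assms(5)]) (simp add: less_imp_le)

  have x_sq: "(x j)\<^sup>2 = d j" for j
    using d_pos[of j] by (simp add: x_def)
  have x_in: "x \<in> ?B"
    using assms(2,4) by (simp add: ball_B_iff_tails x_sq tail)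

  have lower: "R \<le> max_risk M \<xi> \<epsilon> \<sigma> ?B (linear_estimator l')" for l'
  proof -
    have "R \<le> risk M \<xi> \<epsilon> \<sigma> (linear_estimator l') x"
      unfolding R_def risk_linear_estimator[OF assms(7)] x_sq
      using bias_variance_ge_min[OF dq_pos]
      by (intro suminf_le ennreal_leI) (simp_all add: q_def)
    also have "\<dots> \<le> max_risk M \<xi> \<epsilon> \<sigma> ?B (linear_estimator l')"
      unfolding max_risk_def by (rule SUP_upper[OF x_in])
    finally show ?thesis .
  qed

  (* The bias factor is q j / (d j + q j), which increases because q j / d j does by the ratio
     condition. *)
  have bias: "1 - l j = q j / (d j + q j)" for j
    using dq_pos[of j] by (simp add: l_def field_simps)
  have "1 - l j \<le> 1 - l (Suc j)" for j
  proof -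
    have "(\<sigma> j)\<^sup>2 * (a (j + 1) - a (j + 2)) < (\<sigma> (j + 1))\<^sup>2 * (a j - a (j + 1))"
      using assms(9)[of j] decr_pos[of "j + 1"] assms(6)[of j]
      by (simp add: less_divide_eq)
    then have "\<epsilon>\<^sup>2 * P0 * ((\<sigma> j)\<^sup>2 * (a (j + 1) - a (j + 2)))
        \<le> \<epsilon>\<^sup>2 * P0 * ((\<sigma> (j + 1))\<^sup>2 * (a j - a (j + 1)))"
      using assms(1,2) by (intro mult_left_mono) auto
    then have "q j * d (Suc j) \<le> q (Suc j) * d j"
      by (simp add: d_def q_def mult_ac)
    then show ?thesis
      using dq_pos[of j] dq_pos[of "Suc j"] unfolding bias
      by (simp add: divide_le_eq le_divide_eq) (simp add: field_simps)
  qed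
  then have "incseq (\<lambda>j. 1 - l j)"
    by (rule incseq_SucI)
  moreover have bias_nonneg: "0 \<le> 1 - l j" for j
    unfolding bias using q_pos[of j] dq_pos[of j] by simp
  ultimately have weights: "incseq (\<lambda>j. (1 - l j)\<^sup>2)"
    by (auto simp: incseq_def intro!: power_mono)

  have upper: "max_risk M \<xi> \<epsilon> \<sigma> ?B (linear_estimator l) \<le> R"
    unfolding max_risk_def
  proof (rule SUP_least)
    fix z assume "z \<in> ?B"
    then have tails_le: "(\<Sum>j. ennreal ((z (k + j))\<^sup>2)) \<le> (\<Sum>j. ennreal (d (k + j)))" for k
      using assms(2,4) by (simp add: ball_B_iff_tails tail)
    have "risk M \<xi> \<epsilon> \<sigma> (linear_estimator l) z
        = (\<Sum>j. ennreal ((1 - l j)\<^sup>2) * ennreal ((z j)\<^sup>2)) + (\<Sum>j. ennreal (q j * (l j)\<^sup>2))"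
      unfolding risk_linear_estimator[OF assms(7)] q_def
      by (simp add: ennreal_plus ennreal_mult suminf_add)
    also have "\<dots> \<le> (\<Sum>j. ennreal ((1 - l j)\<^sup>2) * ennreal (d j)) + (\<Sum>j. ennreal (q j * (l j)\<^sup>2))"
      by (intro add_right_mono suminf_incseq_weights_mono weights tails_le) simp
    also have "\<dots> = (\<Sum>j. ennreal ((1 - l j)\<^sup>2 * d j + q j * (l j)\<^sup>2))"
      using d_pos q_pos by (simp add: ennreal_plus ennreal_mult suminf_add less_imp_le)
    also have "\<dots> = R"
      unfolding R_def l_def bias_variance_min[OF dq_pos] ..
    finally show "risk M \<xi> \<epsilon> \<sigma> (linear_estimator l) z \<le> R" .
  qed

  have max_risk_l: "max_risk M \<xi> \<epsilon> \<sigma> ?B (linear_estimator l) = R"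
    using upper lower by (rule antisym)
  have minimax: "linear_minimax_risk M \<xi> \<epsilon> \<sigma> ?B = R"
    unfolding linear_minimax_risk_def
  proof (rule antisym)
    show "(INF l'. max_risk M \<xi> \<epsilon> \<sigma> ?B (linear_estimator l')) \<le> R"
      unfolding max_risk_l[symmetric] by (rule INF_lower) simp
  qed (rule INF_greatest, rule lower)

  have summand: "d j * q j / (d j + q j) = \<epsilon>\<^sup>2 * r j" for j
    by (simp add: r_def d_def q_def)
  have r_nonneg: "0 \<le> r j" for j
    unfolding r_def using assms(2) decr_pos[of j] dq_pos[of j] by simp
  have r_le: "\<epsilon>\<^sup>2 * r j \<le> d j" for j
    unfolding summand[symmetric] using d_pos[of j] dq_pos[of j] by (simp add: divide_le_eq distrib_left)
  have "summable d"
    using sums_summable[OF decrements_tail_sums[OF assms(5), of P0 0]] by (simp add: d_def[abs_def])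
  then have summable_term: "summable (\<lambda>j. \<epsilon>\<^sup>2 * r j)"
  proof (rule summable_comparison_test'[where N = 0])
    show "norm (\<epsilon>\<^sup>2 * r j) \<le> d j" for j
      using r_le[of j] r_nonneg[of j] by (simp add: abs_mult)
  qed
  then have summable_r: "summable r"
    using assms(1) by (simp add: summable_cmult_iff)
  have "R = ennreal (\<Sum>j. \<epsilon>\<^sup>2 * r j)"
    unfolding R_def summand by (rule suminf_ennreal2[OF _ summable_term]) (simp add: r_nonneg)
  then have R_eq: "R = ennreal (\<epsilon>\<^sup>2 * (\<Sum>j. r j))"
    using summable_r by (simp add: suminf_mult)

  have "linear_minimax M \<xi> \<epsilon> \<sigma> ?B (linear_estimator l)"
    by (simp add: linear_minimax_def max_risk_l minimax)
  with summable_r minimax R_eq show ?thesis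
    unfolding l_def r_def d_def q_def by simp
qed

end
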